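(* Let $k<t$ be odd positive integers such that $t \geq 825$ and $k,t$ are coprime (so that the distance graph $D(k,t)$ is connected). Then $\chi_{\rho}(D(k,t)) \leq 30$.
   Context: For positive integers $k<t$, the distance graph $D(k,t)$ is the infinite simple undirected graph with vertex set $\mathbb{Z}$ in which two distinct integers $i,j$ are adjacent if and only if $|i-j|\in\{k,t\}$. For a connected graph $G$, $\mathrm{dist}_G(u,v)$ denotes the graph distance. For a positive integer $i$, an $i$-packing is a set $X_i$ of vertices such that any two distinct $u,v\in X_i$ satisfy $\mathrm{dist}_G(u,v)>i$. A packing $p$-coloring of $G$ is a partition of $V(G)$ into disjoint (possibly empty) classes $X_1,\dots,X_p$ such that each $X_i$ is an $i$-packing. The packing chromatic number $\chi_\rho(G)$ is the smallest integer $p$ for which $G$ has a packing $p$-coloring. *)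

theory Defs
  imports
    "Graph_Theory.Graph_Theory"
    "HOL-Library.Extended_Nat"
    "HOL-Library.Disjoint_Sets"
begin

text \<open>
  As usual in \<^theory>\<open>Graph_Theory.Digraph\<close>, a simple undirected graph is a loop-free
  symmetric digraph. The locales \<open>graph\<close> and \<open>pair_graph\<close> also ask for finiteness, so
  the infinite distance graph is a \<^locale>\<open>pair_bidirected_digraph\<close> only.
\<close>

definition distance_graph :: "nat \<Rightarrow> nat \<Rightarrow> int pair_pre_digraph" where
  "distance_graph k t =
    \<lparr> pverts = UNIV, parcs = {(i, j). i \<noteq> j \<and> \<bar>i - j\<bar> \<in> {int k, int t}} \<rparr>"

lemma distance_graph_simps [simp]:
  "pverts (distance_graph k t) = UNIV"
  "parcs (distance_graph k t) = {(i, j). i \<noteq> j \<and> \<bar>i - j\<bar> \<in> {int k, int t}}"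
  by (simp_all add: distance_graph_def)

lemma pair_bidirected_digraph_distance_graph:
  "pair_bidirected_digraph (distance_graph k t)"
  by unfold_locales (auto simp: symmetric_def sym_def abs_minus_commute)

context wf_digraph
begin

text \<open>
  Shortest-path length with unit weights. Its value is \<open>\<infinity>\<close> between vertices that no walk joins.
\<close>

definition graph_dist :: "'a \<Rightarrow> 'a \<Rightarrow> ereal" where
  "graph_dist u v = \<mu> (\<lambda>_. 1) u v"

definition packing :: "nat \<Rightarrow> 'a set \<Rightarrow> bool" where
  "packing i X \<longleftrightarrow>
    X \<subseteq> verts G \<and> (\<forall>u\<in>X. \<forall>v\<in>X. u \<noteq> v \<longrightarrow> graph_dist u v > ereal (real i))"

definition packing_coloring :: "nat \<Rightarrow> (nat \<Rightarrow> 'a set) \<Rightarrow> bool" where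
  "packing_coloring p X \<longleftrightarrow>
    disjoint_family_on X {1..p} \<and> (\<Union>i\<in>{1..p}. X i) = verts G \<and> (\<forall>i\<in>{1..p}. packing i (X i))"

text \<open>
  The infimum in \<^typ>\<open>enat\<close> is the least \<open>p\<close> if a packing colouring with finitely many
  classes exists, and \<open>\<infinity>\<close> otherwise. An upper bound thus includes existence.
\<close>

definition packing_chromatic_number :: enat where
  "packing_chromatic_number = (INF p\<in>{p. \<exists>X. packing_coloring p X}. enat p)"

end

lemma strongly_connected_distance_graph:
  assumes "0 < k" "0 < t" "coprime k t"
  shows "strongly_connected (with_proj (distance_graph k t))"
proof -
  let ?R = "{(i, j). i \<noteq> j \<and> \<bar>i - j\<bar> \<in> {int k, int t}}"
  have step: "(i, i + a * d) \<in> ?R\<^sup>*" if "d = int k \<or> d = int t" for i a d :: int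
  proof (induction a rule: int_induct [where k = 0])
    case base
    then show ?case by simp
  next
    case (step1 a)
    have "(i + a * d, i + (a + 1) * d) \<in> ?R"
      using that assms by (auto simp: algebra_simps)
    with step1 show ?case by (meson rtrancl.rtrancl_into_rtrancl)
  next
    case (step2 a)
    have "(i + a * d, i + (a - 1) * d) \<in> ?R"
      using that assms by (auto simp: algebra_simps)
    with step2 show ?case by (meson rtrancl.rtrancl_into_rtrancl)
  qed
  have "(i, j) \<in> ?R\<^sup>*" for i j :: int
  proof -
    have "coprime (int k) (int t)" using assms by simp
    then obtain a b where ab: "a * int k + b * int t = 1"
      using bezout_int [of "int k" "int t"] by auto
    have "j = i + (j - i) * (a * int k + b * int t)"
      by (simp add: ab)
    then have j: "j = (i + ((j - i) * a) * int k) + ((j - i) * b) * int t"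
      by (simp add: algebra_simps)
    have "(i, i + ((j - i) * a) * int k) \<in> ?R\<^sup>*"
      by (rule step) simp
    moreover have "(i + ((j - i) * a) * int k,
        (i + ((j - i) * a) * int k) + ((j - i) * b) * int t) \<in> ?R\<^sup>*"
      by (rule step) simp
    ultimately show ?thesis
      using j by (metis (no_types, lifting) rtrancl_trans)
  qed
  then show ?thesis
    unfolding strongly_connected_def reachable_def with_proj_simps distance_graph_simps
    by (blast intro: rtrancl_consistent_rtrancl_on)
qed

end

theory Submission
  imports Defs
begin

text \<open>
  The map \<open>(x, y) \<mapsto> k x + t y\<close> presents \<open>D(k, t)\<close> as the square lattice modulo the vector \<open>(t, -k)\<close>.
  Since \<open>k\<close> and \<open>t\<close> are odd, the checkerboard of the lattice survives in the quotient as the parity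
  of the vertex, and all odd vertices get colour 1. On the even vertices \<open>2 n\<close> write
  \<open>n = b u - a v\<close> with \<open>a = (t - k) / 2\<close>, \<open>b = (t + k) / 2\<close> and \<open>0 \<le> v < b\<close>. A pair
  \<open>(u, v)\<close> names the same vertex as \<open>(u + a, v + b)\<close>. Up to this identification, distances between
  even vertices are twice the king-move distances of the points \<open>(u, v)\<close>, so two points of colour
  \<open>c\<close> must differ by more than \<open>c div 2\<close> in one of the two coordinates.

  Every row \<open>v\<close> is now coloured by a pattern in which each colour \<open>c\<close> that occurs fills one residue
  class modulo some \<open>g > c div 2\<close>. This settles two points of the same row. For different rows no
  relative position is controlled at all: rows that share a colour \<open>c\<close> are more than \<open>c div 2\<close>
  apart. Because of that, the shift by \<open>a\<close> that occurs when \<open>v\<close> passes from \<open>b - 1\<close> to \<open>0\<close> does no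
  harm, and the whole problem becomes a scheduling problem: arrange \<open>b\<close> row patterns in a
  circle so that rows sharing the colour \<open>c\<close> are more than \<open>c div 2\<close> steps apart
  (\<open>packing_chromatic_number_le_of_schedule\<close>).

  Three lists of rows, of lengths 16, 20 and 33, solve it. The first one may follow itself, and
  either of the others may stand between two copies of it. Hence circles of length
  \<open>16 l + 36 i + 49 j\<close> exist for all \<open>l\<close>, \<open>i\<close>, \<open>j\<close>, which covers every
  \<open>b \<ge> 413\<close> (\<open>exists_schedule\<close>).
\<close>

section \<open>Distances in the distance graph\<close>

lemma wf_digraph_distance_graph: "wf_digraph (with_proj (distance_graph k t))"
proof -
  interpret pair_bidirected_digraph "distance_graph k t"
    by (rule pair_bidirected_digraph_distance_graph)
  show ?thesis
    by unfold_locales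
qed

text \<open>
  Each arc of a walk is one unit step in one of the two lattice directions. The coordinates
  \<open>x\<close>, \<open>y\<close> are not unique, since \<open>(t, -k)\<close> moves no vertex.
\<close>

lemma awalk_displacement:
  fixes k t :: nat
  assumes "pre_digraph.awalk (with_proj (distance_graph k t)) u p v"
  shows "\<exists>x y. v - u = int k * x + int t * y \<and> \<bar>x\<bar> + \<bar>y\<bar> \<le> int (length p)"
  using assms
proof (induction p arbitrary: u)
  case Nil
  then have "v = u"
    by (simp add: pre_digraph.awalk_def pre_digraph.cas.simps)
  then show ?case
    by (intro exI[of _ 0]) simp
next
  case (Cons e p)
  interpret wf_digraph "with_proj (distance_graph k t)"
    by (rule wf_digraph_distance_graph)
  obtain w where e: "e = (u, w)" and arc: "(u, w) \<in> parcs (distance_graph k t)" and "awalk w p v"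
    using Cons.prems by (cases e) (auto simp: awalk_Cons_iff)
  with Cons.IH obtain x y where xy: "v - w = int k * x + int t * y" "\<bar>x\<bar> + \<bar>y\<bar> \<le> int (length p)"
    by blast
  from arc have "\<bar>u - w\<bar> = int k \<or> \<bar>u - w\<bar> = int t"
    by simp
  then consider "w - u = int k" | "w - u = - int k" | "w - u = int t" | "w - u = - int t"
    by linarith
  then show ?case
  proof cases
    case 1
    with xy show ?thesis by (intro exI[of _ "x + 1"] exI[of _ y]) (auto simp: algebra_simps)
  next
    case 2
    with xy show ?thesis by (intro exI[of _ "x - 1"] exI[of _ y]) (auto simp: algebra_simps)
  next
    case 3
    with xy show ?thesis by (intro exI[of _ x] exI[of _ "y + 1"]) (auto simp: algebra_simps)
  next
    case 4
    with xy show ?thesis by (intro exI[of _ x] exI[of _ "y - 1"]) (auto simp: algebra_simps)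
  qed
qed

text \<open>
  Reduces the graph-theoretic statement to arithmetic: only the displacements with small
  lattice length have to be checked.
\<close>

lemma packing_chromatic_number_leI:
  fixes k t p :: nat and f :: "int \<Rightarrow> nat"
  assumes range: "\<And>n. f n \<in> {1..p}"
    and sep: "\<And>n n' x y. \<lbrakk>f n = f n'; n' - n = int k * x + int t * y;
      \<bar>x\<bar> + \<bar>y\<bar> \<le> int (f n)\<rbrakk> \<Longrightarrow> n = n'"
  shows "wf_digraph.packing_chromatic_number (with_proj (distance_graph k t)) \<le> enat p"
proof -
  interpret wf_digraph "with_proj (distance_graph k t)"
    by (rule wf_digraph_distance_graph)
  have far: "graph_dist u v > ereal (real i)" if uv: "f u = i" "f v = i" "u \<noteq> v" for i u v
  proof -
    have "ereal (real (i + 1)) \<le> awalk_cost (\<lambda>_. 1) q" if q: "awalk u q v" for q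
    proof -
      obtain x y where "v - u = int k * x + int t * y" "\<bar>x\<bar> + \<bar>y\<bar> \<le> int (length q)"
        using awalk_displacement[OF q] by blast
      with sep[of u v x y] uv have "i < length q"
        by force
      moreover have "awalk_cost (\<lambda>_. 1) q = real (length q)"
        by (induction q) (auto simp: awalk_cost_def)
      ultimately show ?thesis
        by simp
    qed
    then have "ereal (real (i + 1)) \<le> graph_dist u v"
      unfolding graph_dist_def \<mu>_def by (intro INF_greatest) auto
    then show ?thesis
      by (rule less_le_trans[rotated]) simp
  qed
  have "packing_coloring p (\<lambda>i. {n. f n = i})"
    unfolding packing_coloring_def packing_def disjoint_family_on_def
    using range far by auto
  then show ?thesis
    unfolding packing_chromatic_number_def by (auto intro: INF_lower2)
qed

section \<open>Round-robin colourings of a line\<close>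

text \<open>
  A pattern colours \<open>\<int>\<close> by taking turns: in \<open>Split ps\<close> the members of \<open>ps\<close> colour the residue
  classes modulo \<open>length ps\<close>, each of them reindexed by \<open>\<int>\<close>. Every position is coloured by
  construction, whatever the gaps are.
\<close>

datatype pattern = Colour nat | Split "pattern list"

primrec colour_at :: "pattern \<Rightarrow> int \<Rightarrow> nat" where
  "colour_at (Colour c) = (\<lambda>u. c)"
| "colour_at (Split ps) =
    (\<lambda>u. (map colour_at ps ! nat (u mod int (length ps))) (u div int (length ps)))"

text \<open>
  Lists each colour with the modulus of the residue class that it fills, for a pattern that itself
  lives on a residue class modulo \<open>g\<close>.
\<close>

primrec colour_gaps :: "pattern \<Rightarrow> nat \<Rightarrow> (nat \<times> nat) list" where
  "colour_gaps (Colour c) = (\<lambda>g. [(c, g)])"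
| "colour_gaps (Split ps) = (\<lambda>g. concat (map (\<lambda>f. f (length ps * g)) (map colour_gaps ps)))"

primrec colours :: "pattern \<Rightarrow> nat list" where
  "colours (Colour c) = [c]"
| "colours (Split ps) = concat (map colours ps)"

primrec splits_nonempty :: "pattern \<Rightarrow> bool" where
  "splits_nonempty (Colour c) = True"
| "splits_nonempty (Split ps) = (ps \<noteq> [] \<and> list_all id (map splits_nonempty ps))"

lemma nat_mod_length_less:
  assumes "xs \<noteq> []"
  shows "nat (u mod int (length xs)) < length xs"
  using assms by (simp add: nat_less_iff)

lemma colour_at_Split:
  assumes "ps \<noteq> []"
  shows "colour_at (Split ps) u =
    colour_at (ps ! nat (u mod int (length ps))) (u div int (length ps))"
  using nat_mod_length_less[OF assms] by simp

lemma colour_gaps_Split: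
  "colour_gaps (Split ps) g = concat (map (\<lambda>p. colour_gaps p (length ps * g)) ps)"
  by (simp add: comp_def)

lemma map_fst_colour_gaps: "map fst (colour_gaps p g) = colours p"
proof (induction p arbitrary: g)
  case (Split ps)
  then show ?case
    unfolding colour_gaps_Split by (auto simp: map_concat comp_def cong: map_cong)
qed simp

lemma colour_at_mem_colour_gaps:
  assumes "splits_nonempty p"
  shows "\<exists>h. (colour_at p u, h) \<in> set (colour_gaps p g)"
  using assms
proof (induction p arbitrary: u g)
  case (Split ps)
  let ?i = "nat (u mod int (length ps))"
  have i: "?i < length ps" and ne: "ps \<noteq> []"
    using Split.prems nat_mod_length_less by auto
  then have "splits_nonempty (ps ! ?i)"
    using Split.prems by (auto simp: list_all_iff)
  then show ?case
    using Split.IH[OF nth_mem[OF i], of "u div int (length ps)" "length ps * g"] nth_mem[OF i]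
    unfolding colour_at_Split[OF ne] colour_gaps_Split by (auto simp del: nth_mem)
qed simp

lemma colour_at_mem_colours:
  assumes "splits_nonempty p"
  shows "colour_at p u \<in> set (colours p)"
  using colour_at_mem_colour_gaps[OF assms, of u 1]
  unfolding map_fst_colour_gaps[of p 1, symmetric] by force

lemma distinct_concat_nth_unique:
  assumes "distinct (concat xss)" and "i < length xss" and "j < length xss"
    and "x \<in> set (xss ! i)" and "x \<in> set (xss ! j)"
  shows "i = j"
  using assms
proof (induction xss arbitrary: i j)
  case (Cons xs xss)
  then show ?case
    by (cases i; cases j) (auto, (blast intro: nth_mem)+)
qed simp

text \<open>
  A colour listed once sits at a single leaf, so two positions of that colour take the same turn
  at every \<open>Split\<close> above the leaf. They are therefore congruent modulo the product of the lengths met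
  on the way, which is what \<open>colour_gaps\<close> records. The factor \<open>g\<close> makes the induction go
  through.
\<close>

lemma colour_at_eq_imp_dvd:
  assumes "splits_nonempty p" and "distinct (colours p)"
    and "colour_at p u = c" and "colour_at p u' = c"
  shows "\<exists>h. (c, h) \<in> set (colour_gaps p g) \<and> int h dvd int g * (u' - u)"
  using assms
proof (induction p arbitrary: u u' g)
  case (Split ps)
  let ?n = "int (length ps)"
  let ?i = "nat (u mod ?n)" and ?i' = "nat (u' mod ?n)" and ?g = "length ps * g"
  have ne: "ps \<noteq> []"
    using Split.prems by simp
  note less = nat_mod_length_less[OF ne]
  have nonempty: "splits_nonempty (ps ! j)" if "j < length ps" for j
    using Split.prems that by (auto simp: list_all_iff)
  have at: "colour_at (ps ! ?i) (u div ?n) = c" "colour_at (ps ! ?i') (u' div ?n) = c"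
    using Split.prems(3,4) unfolding colour_at_Split[OF ne] .
  have dist: "distinct (concat (map colours ps))"
    using Split.prems(2) by simp
  have colour_mem: "c \<in> set (colours (ps ! j))"
    if "j < length ps" "colour_at (ps ! j) w = c" for j w
    using colour_at_mem_colours[OF nonempty[OF that(1)], of w] that(2) by simp
  have same: "?i = ?i'"
    using distinct_concat_nth_unique[OF dist, of ?i ?i' c] less[of u] less[of u']
      colour_mem[OF less at(1)] colour_mem[OF less at(2)] by simp
  have "distinct (colours (ps ! ?i))"
    using dist less[of u] by (auto simp: distinct_concat_iff)
  from Split.IH[OF nth_mem[OF less] nonempty[OF less] this at(1)] at(2)
  obtain h where h: "(c, h) \<in> set (colour_gaps (ps ! ?i) ?g)"
    "int h dvd int ?g * (u' div ?n - u div ?n)"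
    unfolding same by blast
  have "u mod ?n = u' mod ?n"
    using same ne by (simp add: eq_nat_nat_iff)
  then have "u' - u = ?n * (u' div ?n - u div ?n)"
    using mult_div_mod_eq[of ?n u] mult_div_mod_eq[of ?n u'] unfolding right_diff_distrib
    by linarith
  then have "int g * (u' - u) = int ?g * (u' div ?n - u div ?n)"
    by (simp add: mult_ac)
  with h(2) have "int h dvd int g * (u' - u)"
    by (simp only:)
  moreover have "(c, h) \<in> set (colour_gaps (Split ps) g)"
    using h(1) nth_mem[OF less[of u]] unfolding colour_gaps_Split by (auto simp del: nth_mem)
  ultimately show ?case
    by blast
qed simp

text \<open>
  The patterns admitted in a row. Colour 1 belongs to the odd vertices, and \<open>c < 2 g\<close> is
  \<open>c div 2 < g\<close>: points of colour \<open>c\<close> in one row have king-move distance at least \<open>g\<close>.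
\<close>

definition row_pattern :: "pattern \<Rightarrow> bool" where
  "row_pattern p \<longleftrightarrow> splits_nonempty p \<and> distinct (colours p) \<and>
    (\<forall>(c, g)\<in>set (colour_gaps p 1). 2 \<le> c \<and> c \<le> 30 \<and> c < 2 * g)"

lemma row_pattern_colour_bounds:
  assumes "row_pattern p" and "c \<in> set (colours p)"
  shows "2 \<le> c" and "c \<le> 30"
  using assms unfolding row_pattern_def map_fst_colour_gaps[of p 1, symmetric] by auto

lemma row_pattern_colour_at:
  assumes "row_pattern p"
  shows "colour_at p u \<in> set (colours p)"
  using assms colour_at_mem_colours unfolding row_pattern_def by blast

lemma row_pattern_separated:
  assumes "row_pattern p" and "colour_at p u = colour_at p u'"
    and "\<bar>u' - u\<bar> \<le> int (colour_at p u div 2)"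
  shows "u = u'"
proof -
  let ?c = "colour_at p u"
  have "splits_nonempty p" and "distinct (colours p)"
    and gaps: "\<forall>(c, g)\<in>set (colour_gaps p 1). c < 2 * g"
    using assms(1) unfolding row_pattern_def by blast+
  then obtain h where h: "(?c, h) \<in> set (colour_gaps p 1)" "int h dvd int 1 * (u' - u)"
    using colour_at_eq_imp_dvd[of p u ?c u' 1] assms(2) by metis
  then have "?c < 2 * h"
    using gaps by blast
  then have "int (?c div 2) < int h"
    by (simp add: less_mult_imp_div_less mult.commute)
  show ?thesis
  proof (rule ccontr)
    assume "u \<noteq> u'"
    with h(2) have "\<bar>int h\<bar> \<le> \<bar>u' - u\<bar>"
      by (intro dvd_imp_le_int) simp_all
    with assms(3) \<open>int (?c div 2) < int h\<close> show False
      by simp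
  qed
qed

section \<open>Schedules of rows\<close>

text \<open>
  Each inner list holds the colours of one row. The condition on a pair of rows is symmetric, so
  every row is compared with the later ones only.
\<close>

primrec spaced :: "nat list list \<Rightarrow> bool" where
  "spaced [] = True"
| "spaced (cs # rows) =
    ((\<forall>c\<in>set cs. \<forall>ds\<in>set (take (c div 2) rows). c \<notin> set ds) \<and> spaced rows)"

lemma spaced_nth:
  assumes "spaced rows" and "i < j" and "j < length rows"
    and "c \<in> set (rows ! i)" and "c \<in> set (rows ! j)"
  shows "c div 2 < j - i"
  using assms
proof (induction rows arbitrary: i j)
  case (Cons cs rows)
  from Cons.prems(2) obtain j' where j: "j = Suc j'"
    by (cases j) auto
  show ?case
  proof (cases i)
    case 0
    have "\<not> j' < c div 2"
    proof
      assume "j' < c div 2"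
      with Cons.prems(3) j have "rows ! j' \<in> set (take (c div 2) rows)"
        by (auto simp: in_set_conv_nth intro!: exI[of _ j'])
      with Cons.prems 0 j show False
        by auto
    qed
    with 0 j show ?thesis
      by simp
  next
    case (Suc i')
    with Cons j show ?thesis
      by simp
  qed
qed simp

text \<open>
  Conflicts reach at most \<open>30 div 2 = 15\<close> rows, so a middle part of that length separates its two
  neighbours and only adjacent parts need to be compared.
\<close>

lemma spaced_append:
  assumes "spaced (P @ Q)" and "spaced (Q @ S)" and "15 \<le> length Q"
    and "\<forall>cs\<in>set P. \<forall>c\<in>set cs. c \<le> 30"
  shows "spaced (P @ Q @ S)"
  using assms(1,4)
proof (induction P)
  case Nil
  show ?case
    using assms(2) by simp
next
  case (Cons cs P)
  have "take (c div 2) (P @ Q @ S) = take (c div 2) (P @ Q)" if "c \<in> set cs" for c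
  proof -
    have "c div 2 \<le> 15"
      using Cons.prems(2) that by (auto dest!: bspec)
    then show ?thesis
      using assms(3) by simp
  qed
  then show ?case
    using Cons by (simp del: take_append)
qed

text \<open>
  Unrolling a circle of rows twice shows every pair of rows along both arcs between them. The
  second inequality bounds the arc through the seam.
\<close>

lemma spaced_cyclic:
  assumes "spaced (rows @ rows)" and "i < length rows" and "j < length rows" and "i \<noteq> j"
    and "c \<in> set (rows ! i)" and "c \<in> set (rows ! j)"
  shows "int (c div 2) < \<bar>int j - int i\<bar>"
    and "\<bar>int j - int i\<bar> + int (c div 2) < int (length rows)"
proof -
  have *: "i + c div 2 < j \<and> j + c div 2 < i + length rows"
    if "i < j" "j < length rows" "c \<in> set (rows ! i)" "c \<in> set (rows ! j)" for i j
    using spaced_nth[OF assms(1), of i j c] spaced_nth[OF assms(1), of j "i + length rows" c] that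
    by (simp add: nth_append less_diff_conv add.commute)
  define d where "d = c div 2"
  have "i + d < j \<and> j + d < i + length rows \<or> j + d < i \<and> i + d < j + length rows"
    using *[of i j] *[of j i] assms(2-) unfolding d_def by (cases i j rule: linorder_cases) simp_all
  then show "int (c div 2) < \<bar>int j - int i\<bar>"
    and "\<bar>int j - int i\<bar> + int (c div 2) < int (length rows)"
    using assms(2,3) unfolding d_def[symmetric] by auto
qed

section \<open>From schedules to packing colourings\<close>

lemma lattice_coordinates:
  fixes a b :: int
  assumes "coprime a b" and "0 < b"
  shows "\<exists>u v. 0 \<le> v \<and> v < b \<and> n = b * u - a * v"
proof -
  obtain r s where rs: "r * a + s * b = 1"
    using bezout_int[of a b] assms(1) by auto
  let ?v = "(- n * r) mod b" and ?q = "(- n * r) div b"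
  have "n = n * (r * a + s * b)"
    using rs by simp
  also have "\<dots> = b * (n * s) - a * (- n * r)"
    by (simp add: algebra_simps)
  also have "\<dots> = b * (n * s) - a * (b * ?q + ?v)"
    by (simp only: mult_div_mod_eq)
  also have "\<dots> = b * (n * s - a * ?q) - a * ?v"
    by (simp only: algebra_simps)
  finally show ?thesis
    using pos_mod_sign[OF assms(2)] pos_mod_bound[OF assms(2)] by blast
qed

text \<open>
  A displacement \<open>k x + t y\<close> between even vertices has \<open>x = p - q\<close>, \<open>y = p + q\<close> and equals
  \<open>2 (b p + a q)\<close>. Comparing with \<open>n = b u - a v\<close> and using that \<open>a\<close> and \<open>b\<close> are coprime, \<open>v\<close> changes
  by \<open>-q\<close> modulo \<open>b\<close>, and \<open>u\<close> by \<open>p\<close> if \<open>v\<close> changes by exactly \<open>-q\<close>. If the rows differ, the spacing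
  along the circle forbids \<open>\<bar>q\<bar> \<le> c div 2\<close>. If they agree, then \<open>q = 0\<close>, and the row pattern
  forbids \<open>0 < \<bar>p\<bar> \<le> c div 2\<close>.
\<close>

lemma packing_chromatic_number_le_of_schedule:
  fixes k t :: nat
  assumes "odd k" and "odd t" and "k < t" and "coprime k t"
    and len: "2 * length R = k + t" and len_gt: "15 < length R"
    and rows: "\<forall>p\<in>set R. row_pattern p"
    and spaced: "spaced (map colours (R @ R))"
  shows "wf_digraph.packing_chromatic_number (with_proj (distance_graph k t)) \<le> enat 30"
proof -
  define a b :: int where "a = int t - int (length R)" and "b = int (length R)"
  have k: "int k = b - a" and t: "int t = b + a" and b: "15 < b"
    using len len_gt unfolding a_def b_def by linarith+
  have "coprime a b"
  proof (rule coprimeI)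
    fix d
    assume "d dvd a" and "d dvd b"
    then have "d dvd int k" and "d dvd int t"
      unfolding k t by simp_all
    moreover have "coprime (int k) (int t)"
      using \<open>coprime k t\<close> by simp
    ultimately show "is_unit d"
      by (rule coprime_common_divisor[rotated])
  qed
  then have "\<forall>n. \<exists>u v. 0 \<le> v \<and> v < b \<and> n = b * u - a * v"
    using lattice_coordinates[of a b] b by simp
  then obtain U V where coord: "\<And>n. 0 \<le> V n" "\<And>n. V n < b" "\<And>n. n = b * U n - a * V n"
    by metis
  define row where "row n = R ! nat (V n)" for n
  have row_less: "nat (V n) < length R" for n
    using coord(1,2)[of n] unfolding b_def by linarith
  then have row: "row_pattern (row n)" for n
    using rows unfolding row_def by simp
  define f where "f n = (if odd n then 1 else colour_at (row (n div 2)) (U (n div 2)))" for n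
  show ?thesis
  proof (rule packing_chromatic_number_leI)
    show "f n \<in> {1..30}" for n
      using row_pattern_colour_bounds[OF row row_pattern_colour_at[OF row], of "n div 2" "U (n div 2)"]
      unfolding f_def by simp
  next
    fix n n' x y
    assume same: "f n = f n'" and diff: "n' - n = int k * x + int t * y"
      and near: "\<bar>x\<bar> + \<bar>y\<bar> \<le> int (f n)"
    have parity: "even (n' - n) \<longleftrightarrow> even (x + y)"
      unfolding diff using \<open>odd k\<close> \<open>odd t\<close> by simp
    have odd_iff: "odd m \<longleftrightarrow> f m = 1" for m
      using row_pattern_colour_bounds(1)[OF row row_pattern_colour_at[OF row], of "m div 2" "U (m div 2)"]
      unfolding f_def by auto
    then have "odd n \<longleftrightarrow> odd n'"
      using same by simp
    then have "even (x + y)"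
      using parity by simp
    show "n = n'"
    proof (cases "odd n")
      case True
      then have "\<bar>x\<bar> + \<bar>y\<bar> \<le> 1"
        using near odd_iff by simp
      with \<open>even (x + y)\<close> have "x = 0" and "y = 0"
        by presburger+
      with diff show ?thesis
        by simp
    next
      case False
      define N N' where "N = n div 2" and "N' = n' div 2"
      have n: "n = 2 * N" "n' = 2 * N'"
        using False \<open>odd n \<longleftrightarrow> odd n'\<close> unfolding N_def N'_def by auto
      define c where "c = f n"
      have c: "colour_at (row N) (U N) = c" "colour_at (row N') (U N') = c"
        using same False \<open>odd n \<longleftrightarrow> odd n'\<close> unfolding c_def f_def N_def N'_def by auto
      have c_le: "c div 2 \<le> 15"
        using row_pattern_colour_bounds(2)[OF row row_pattern_colour_at[OF row], of N "U N"] c(1)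
        by simp
      obtain p q where pq: "x = p - q" "y = p + q"
      proof
        show "x = (x + y) div 2 - (y - x) div 2" "y = (x + y) div 2 + (y - x) div 2"
          using \<open>even (x + y)\<close> by presburger+
      qed
      have "int c \<le> 2 * int (c div 2) + 1"
        by linarith
      moreover have "2 * \<bar>p\<bar> \<le> \<bar>x\<bar> + \<bar>y\<bar>" "2 * \<bar>q\<bar> \<le> \<bar>x\<bar> + \<bar>y\<bar>"
        unfolding pq by auto
      ultimately have p_le: "\<bar>p\<bar> \<le> int (c div 2)" and q_le: "\<bar>q\<bar> \<le> int (c div 2)"
        using near unfolding c_def[symmetric] by auto
      have "N' - N = b * p + a * q"
        using diff unfolding n k t pq by (simp add: algebra_simps)
      then have key: "b * (U N' - U N - p) = a * (V N' - V N + q)"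
        using coord(3)[of N] coord(3)[of N'] unfolding right_diff_distrib distrib_left by linarith
      then have "b dvd V N' - V N + q"
        using \<open>coprime a b\<close> by (metis coprime_commute coprime_dvd_mult_right_iff dvd_triv_left)
      \<comment> \<open>Smallness turns the divisibility by \<open>b\<close> into an equation, which is impossible for distinct rows.\<close>
      have "\<bar>V N' - V N + q\<bar> < b \<and> (V N' \<noteq> V N \<longrightarrow> V N' - V N + q \<noteq> 0)"
      proof (cases "V N' = V N")
        case True
        then show ?thesis
          using q_le c_le b by simp
      next
        case False
        then have "nat (V N) \<noteq> nat (V N')"
          using coord(1) by (simp add: eq_nat_nat_iff)
        moreover have "c \<in> set (map colours R ! nat (V N))" "c \<in> set (map colours R ! nat (V N'))"
          using row_pattern_colour_at[OF row, of N "U N"] row_pattern_colour_at[OF row, of N' "U N'"]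
          c row_less unfolding row_def by simp_all
        ultimately have "int (c div 2) < \<bar>V N' - V N\<bar>" "\<bar>V N' - V N\<bar> + int (c div 2) < b"
          using spaced_cyclic[of "map colours R" "nat (V N)" "nat (V N')" c] spaced row_less coord(1)
          unfolding b_def by simp_all
        then show ?thesis
          using q_le by linarith
      qed
      then have "V N' - V N + q = 0" and "V N' = V N"
        using \<open>b dvd V N' - V N + q\<close> zdvd_not_zless[of "\<bar>V N' - V N + q\<bar>" b] by auto
      with key b have "U N' - U N = p"
        by simp
      then have "U N = U N'"
        using row_pattern_separated[OF row, of N "U N" "U N'"] c p_le \<open>V N' = V N\<close>
        unfolding row_def by simp
      with \<open>V N' = V N\<close> have "b * U N - a * V N = b * U N' - a * V N'"
        by simp
      then have "N = N'"
        unfolding coord(3)[symmetric] .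
      with n show ?thesis
        by simp
    qed
  qed
qed

section \<open>Three blocks of rows\<close>

text \<open>
  In the base block and in the block of 20 rows, every second row uses the colours 2 and 3, which
  may recur in every second row. The other rows use alternately 4, 5 and 6, 7, leaving a third or a
  half of their positions to the colours from 8 to 30. The remaining pieces were found by a
  computer search.
\<close>

definition mix :: "nat list \<Rightarrow> pattern" where
  "mix cs = Split (map Colour cs)"

definition row_45 :: "pattern \<Rightarrow> pattern" where
  "row_45 p = Split [Colour 4, Colour 5, p]"

definition row_67 :: "pattern \<Rightarrow> pattern" where
  "row_67 p = Split [mix [6, 7], p]"

definition with_rows_23 :: "pattern list \<Rightarrow> pattern list" where
  "with_rows_23 ps = concat (map (\<lambda>p. [mix [2, 3], p]) ps)"

definition base_block :: "pattern list" where
  "base_block = with_rows_23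
     [row_67 (Split [mix [9, 14], Split [Colour 15, mix [25, 27]]]),
      row_45 (Split [Colour 11, mix [19, 20]]),
      row_67 (Split [Colour 8, Colour 10, mix [16, 18]]),
      row_45 (mix [12, 13, 17]),
      row_67 (Split [mix [14, 15], mix [21, 22, 23]]),
      row_45 (mix [8, 9]),
      row_67 (Split [Colour 10, Colour 11, mix [28, 29, 30]]),
      row_45 (Split [Colour 12, Colour 13, mix [24, 26]])]"

definition even_block :: "pattern list" where
  "even_block = with_rows_23
     [row_67 (Split [Colour 8, Colour 9, mix [14, 19]]),
      row_45 (Split [Colour 11, mix [16, 17]]),
      row_67 (Split [mix [10, 15], mix [18, 20, 21]]),
      row_45 (Split [Colour 8, Split [Colour 23, mix [25, 27]]]),
      row_67 (Split [mix [9, 12], mix [13, 14]]),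
      row_45 (mix [10, 11]),
      row_67 (Split [mix [8, 15], mix [16, 19, 22]]),
      row_45 (Split [Colour 9, Split [Colour 18, mix [29, 30]]]),
      row_67 (Split [Colour 10, Colour 11, mix [13, 17]]),
      row_45 (Split [Colour 8, Split [Colour 12, mix [24, 26]]])]"

text \<open>
  To get an odd number of rows, the alternation must be broken. The row that starts with colour 8
  uses none of 2, ..., 7, so that the rows of 4, 5 and of 6, 7 stay far enough apart where the
  phase of the rows of 2, 3 changes, namely between the two \<open>with_rows_23\<close> parts. The rest of the
  block makes room for the colours spent on that row.
\<close>

definition odd_block :: "pattern list" where
  "odd_block = with_rows_23
     [row_67 (Split [Colour 8, Colour 9, Split [Colour 19, mix [25, 27]]]),
      row_45 (mix [10, 11]),
      row_67 (Split [mix [14, 15], mix [18, 22, 23]]),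
      row_45 (Split [mix [12, 13], mix [20, 21]]),
      row_67 (Split [Colour 8, Colour 9, mix [16, 17]]),
      row_45 (mix [10, 11]),
      row_67 (Split [mix [14, 15], Split [mix [24, 26], mix [29, 30]]]),
      Split [Colour 8, Colour 9, mix [12, 13], mix [18, 19], mix [25, 27, 28]],
      row_45 (mix [10, 11])]
    @ row_67 (Split [mix [16, 17, 20], mix [21, 22, 23]])
    # with_rows_23
     [row_45 (mix [8, 9]),
      row_67 (Split [mix [12, 13], mix [14, 15]]),
      row_45 (mix [10, 11]),
      row_67 (Split [Colour 8, Colour 9, mix [18, 19]]),
      row_45 (Split [Colour 16, Colour 17, mix [24, 29]]),
      row_67 (Split [Split [Colour 12, mix [26, 28]], mix [21, 22, 23]]),
      row_45 (mix [8, 10])]"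

lemmas block_defs = base_block_def even_block_def odd_block_def with_rows_23_def
  row_45_def row_67_def mix_def

lemma length_blocks: "length base_block = 16" "length even_block = 20" "length odd_block = 33"
  by (simp_all add: block_defs)

lemma row_pattern_blocks:
  "\<forall>p\<in>set (base_block @ even_block @ odd_block). row_pattern p"
  by (simp add: block_defs row_pattern_def)

lemma spaced_blocks:
  "spaced (map colours (base_block @ base_block))"
  "spaced (map colours ((base_block @ even_block) @ base_block))"
  "spaced (map colours ((base_block @ odd_block) @ base_block))"
  by (code_simp, code_simp, code_simp)

lemma spaced_prefix: "spaced (P @ Q) \<Longrightarrow> spaced P"
  by (induction P) auto

text \<open>
  Every block begins with \<open>base_block\<close>, which has 16 rows. So conflicts never reach past the copy of
  \<open>base_block\<close> at the beginning of the next block, and \<open>spaced_blocks\<close> covers all pairs. The final copy of \<open>base_block\<close>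
  gives the last block of \<open>w\<close> a successor, too.
\<close>

lemma spaced_concat_blocks:
  assumes "set w \<subseteq> {base_block, base_block @ even_block, base_block @ odd_block}"
  shows "spaced (map colours (concat w @ base_block))"
  using assms
proof (induction w)
  case Nil
  show ?case
    using spaced_prefix spaced_blocks(1) by simp
next
  case (Cons P w)
  have "\<exists>T. concat w @ base_block = base_block @ T"
    using Cons.prems by (cases w) auto
  then obtain T where T: "concat w @ base_block = base_block @ T" ..
  have "spaced (map colours P @ map colours base_block)"
    using Cons.prems spaced_blocks by auto
  moreover have "spaced (map colours base_block @ map colours T)"
    using Cons T by (simp flip: map_append)
  moreover have "\<forall>cs\<in>set (map colours P). \<forall>c\<in>set cs. c \<le> 30"
  proof -
    have "\<forall>p\<in>set P. row_pattern p"
      using Cons.prems row_pattern_blocks by auto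
    then show ?thesis
      using row_pattern_colour_bounds(2) by auto
  qed
  ultimately have "spaced (map colours P @ map colours base_block @ map colours T)"
    by (intro spaced_append) (simp_all add: length_blocks)
  then show ?case
    using T by simp
qed

lemma exists_schedule:
  assumes "413 \<le> n"
  shows "\<exists>R. length R = n \<and> (\<forall>p\<in>set R. row_pattern p) \<and> spaced (map colours (R @ R))"
proof -
  obtain i j l :: nat where n: "n = 49 * j + 36 * i + 16 * l"
  proof
    \<comment> \<open>The blocks have lengths 49, 36 and 16. As \<open>49 mod 4 = 1\<close> and \<open>36 mod 16 = 4\<close>, the number of
      blocks of length 49 corrects \<open>n\<close> modulo 4 and the number of those of length 36 corrects the
      rest modulo 16.\<close>
    define j m where "j = n mod 4" and "m = n div 4 - 12 * j"
    define i l where "i = m mod 4" and "l = m div 4 - 2 * i"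
    have "n = 4 * (n div 4) + j" and "j < 4"
      unfolding j_def by simp_all
    then have m: "n = 49 * j + 4 * m" "24 \<le> m"
      using assms unfolding m_def by linarith+
    have "m = 4 * (m div 4) + i" and "i < 4"
      unfolding i_def by simp_all
    then have "m = 9 * i + 4 * l"
      using m(2) unfolding l_def by linarith
    with m(1) show "n = 49 * j + 36 * i + 16 * l"
      by simp
  qed
  define w where "w = replicate j (base_block @ odd_block)
    @ replicate i (base_block @ even_block) @ replicate l base_block"
  have w: "set w \<subseteq> {base_block, base_block @ even_block, base_block @ odd_block}"
    unfolding w_def by (auto simp: set_replicate_conv_if)
  have "length (concat w) = n"
    unfolding n w_def by (simp add: length_concat sum_list_replicate length_blocks)
  moreover have "\<forall>p\<in>set (concat w). row_pattern p"
    using w row_pattern_blocks by fastforce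
  moreover have "spaced (map colours (concat w @ concat w))"
    using spaced_concat_blocks[of "w @ w"] w spaced_prefix by simp
  ultimately show ?thesis
    by blast
qed

theorem theorem1:
  fixes k t :: nat
  assumes "0 < k" and "k < t"
    and "odd k" and "odd t"
    and "t \<ge> 825"
    and "coprime k t"
  shows "wf_digraph.packing_chromatic_number (with_proj (distance_graph k t)) \<le> 30"
proof -
  have "413 \<le> (k + t) div 2"
    using assms by linarith
  then obtain R where R: "length R = (k + t) div 2" "\<forall>p\<in>set R. row_pattern p"
    "spaced (map colours (R @ R))"
    using exists_schedule by blast
  have "wf_digraph.packing_chromatic_number (with_proj (distance_graph k t)) \<le> enat 30"
  proof (rule packing_chromatic_number_le_of_schedule)
    show "2 * length R = k + t"
      using R(1) assms by simp
    show "15 < length R"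
      using R(1) \<open>413 \<le> (k + t) div 2\<close> by linarith
  qed (use assms R in simp_all)
  then show ?thesis
    by (simp add: numeral_eq_enat)
qed

end
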